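(* Let $(G,\prec)$ be a Nyldon-like set over $A$ and let $w\in A^+$. Then $w$ has exactly one $G$-factorization, and the following procedure outputs it. Maintain a list of blocks, initially the letters of $w$ in order, and an initially empty output list. While the list of blocks is nonempty: if the first block is $\prec$-minimal among the current blocks, remove it from the list and append it to the output; otherwise, take the leftmost occurrence $u$ of a $\prec$-minimal current block (which then has a left neighbour $v\succ u$) and replace the two adjacent blocks $v,u$ by the single block $vu$. The output list is the $G$-factorization of $w$.
   Context: $A$ is a finite alphabet with at least two letters. For $w\in A^+$, a $G$-factorization of $w$ is a sequence $(w_1,\dots,w_k)$, $k\ge 1$, of words of $G$ with $w=w_1w_2\cdots w_k$ and $w_1\preceq w_2\preceq\cdots\preceq w_k$. A Nyldon-like set is a pair $(G,\prec)$ with $G\subseteq A^+$ and $\prec$ a total order on $G$ such that: every letter of $A$ lies in $G$; a word $w$ of length at least $2$ lies in $G$ if and only if $w$ has no $G$-factorization with $k\ge 2$ factors; and for all $f,g\in G$ with $fg\in G$ we have $f\prec fg$. (All blocks arising in the procedure are elements of $G$, so comparing them with $\prec$ makes sense.) *)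

theory Defs
  imports Main "HOL-Library.While_Combinator"
begin

text \<open>Words over an alphabet \<open>A\<close> are lists in \<^term>\<open>lists A\<close>. The total order on \<open>G\<close> is represented
  by its reflexive version \<open>r\<close>: \<open>(u, v) \<in> r\<close> means that \<open>u\<close> precedes or equals \<open>v\<close>.\<close>

definition prec :: "'a list rel \<Rightarrow> 'a list \<Rightarrow> 'a list \<Rightarrow> bool" where
  "prec r u v \<longleftrightarrow> (u, v) \<in> r \<and> u \<noteq> v"

definition nonempty_words :: "'a set \<Rightarrow> 'a list set" where
  "nonempty_words A = lists A - {[]}"

definition G_factorization ::
  "'a list set \<Rightarrow> 'a list rel \<Rightarrow> 'a list \<Rightarrow> 'a list list \<Rightarrow> bool" where
  "G_factorization G r w ws \<longleftrightarrow>
     length ws \<ge> 1 \<and> set ws \<subseteq> G \<and> w = concat ws \<and> successively (\<lambda>u v. (u, v) \<in> r) ws"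

definition nyldon_like :: "'a set \<Rightarrow> 'a list set \<Rightarrow> 'a list rel \<Rightarrow> bool" where
  "nyldon_like A G r \<longleftrightarrow>
     G \<subseteq> nonempty_words A \<and>
     linear_order_on G r \<and>
     (\<forall>a\<in>A. [a] \<in> G) \<and>
     (\<forall>w\<in>nonempty_words A. length w \<ge> 2 \<longrightarrow>
        (w \<in> G \<longleftrightarrow> \<not> (\<exists>ws. G_factorization G r w ws \<and> length ws \<ge> 2))) \<and>
     (\<forall>f\<in>G. \<forall>g\<in>G. f @ g \<in> G \<longrightarrow> prec r f (f @ g))"

definition minimal_block :: "'a list rel \<Rightarrow> 'a list list \<Rightarrow> 'a list \<Rightarrow> bool" where
  "minimal_block r bs u \<longleftrightarrow> u \<in> set bs \<and> \<not> (\<exists>v\<in>set bs. prec r v u)"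

definition leftmost_min :: "'a list rel \<Rightarrow> 'a list list \<Rightarrow> nat" where
  "leftmost_min r bs = (LEAST i. i < length bs \<and> minimal_block r bs (bs ! i))"

text \<open>A state of the procedure is a pair of the list of blocks and the output list.\<close>

definition initial_state :: "'a list \<Rightarrow> 'a list list \<times> 'a list list" where
  "initial_state w = (map (\<lambda>a. [a]) w, [])"

definition step ::
  "'a list rel \<Rightarrow> 'a list list \<times> 'a list list \<Rightarrow> 'a list list \<times> 'a list list" where
  "step r = (\<lambda>(bs, out).
     if minimal_block r bs (hd bs) then (tl bs, out @ [hd bs])
     else let i = leftmost_min r bs
          in (take (i - 1) bs @ [bs ! (i - 1) @ bs ! i] @ drop (i + 1) bs, out))"

text \<open>The result is \<^term>\<open>None\<close> if the loop does not terminate.\<close>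

definition procedure_output :: "'a list rel \<Rightarrow> 'a list \<Rightarrow> 'a list list option" where
  "procedure_output r w =
     map_option snd (while_option (\<lambda>(bs, out). bs \<noteq> []) (step r) (initial_state w))"

inductive reached :: "'a list rel \<Rightarrow> 'a list \<Rightarrow> 'a list list \<times> 'a list list \<Rightarrow> bool"
  for r w where
  init: "reached r w (initial_state w)"
| step: "reached r w (bs, out) \<Longrightarrow> bs \<noteq> [] \<Longrightarrow> reached r w (step r (bs, out))"

end

theory Submission
  imports Defs
begin

text \<open>A list of blocks produced by the merging steps is again such a list when restricted to
  consecutive blocks, because the leftmost minimal block of the whole list is also leftmost minimal
  in every segment containing it. By induction on the length of the word, all blocks lie in \<open>G\<close> and
  every \<open>G\<close>-factorization of the word is obtained by grouping consecutive blocks: a merge of \<open>v\<close>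
  and \<open>u\<close> could only break this if \<open>v\<close> ended a factor and \<open>u\<close> began the next one; but then,
  \<open>u\<close> being minimal, the second factor is \<open>u\<close> itself, whereas the first one lies strictly above
  \<open>u\<close>. Consequently every \<open>G\<close>-factorization equals the output of the procedure.\<close>

section \<open>Block lists, their segments and their groupings\<close>

text \<open>The side conditions of \<open>merge\<close> make \<open>u\<close> the leftmost minimal
  block: ties are excluded on its left and allowed on its right. Removal of a minimal first block is
  not a rule, since \<open>block_list_sublist\<close> accounts for it.\<close>

inductive block_list :: "'a set \<Rightarrow> 'a list rel \<Rightarrow> 'a list list \<Rightarrow> bool" for A r where
  letters: "w \<in> lists A \<Longrightarrow> block_list A r (map (\<lambda>a. [a]) w)"
| merge: "block_list A r (xs @ [v, u] @ ys) \<Longrightarrow> \<forall>c\<in>set (xs @ [v]). prec r u c \<Longrightarrow>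
    \<forall>c\<in>set ys. (u, c) \<in> r \<Longrightarrow> block_list A r (xs @ [v @ u] @ ys)"

lemma block_list_concat_in_lists: "block_list A r bs \<Longrightarrow> concat bs \<in> lists A"
  by (induction rule: block_list.induct) (auto simp: map_concat)

lemma append3_split_at:
  assumes "as @ cs @ bs = xs @ [z] @ ys"
  obtains (left) t where "as = xs @ [z] @ t" "ys = t @ cs @ bs"
    | (mid) s t where "xs = as @ s" "cs = s @ [z] @ t" "ys = t @ bs"
    | (right) s where "xs = as @ cs @ s" "bs = s @ [z] @ ys"
  using assms
  by (auto simp: append_eq_append_conv2 append_eq_Cons_conv Cons_eq_append_conv)

lemma concat_map_concat: "concat (map concat xsss) = concat (concat xsss)"
  by (induction xsss) auto

text \<open>If the merged block lies outside the segment, the segment was already present before the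
  merge; if it lies inside, the same merge is legal within the segment. The lemma gives access to
  tails of a list and to the single groups of a grouping.\<close>

lemma block_list_sublist:
  assumes "block_list A r (as @ cs @ bs)"
  shows "block_list A r cs"
  using assms
proof (induction "as @ cs @ bs" arbitrary: as cs bs rule: block_list.induct)
  case (letters w)
  then obtain w1 w2 w3 where "w = w1 @ w2 @ w3" "cs = map (\<lambda>a. [a]) w2"
    by (metis map_eq_append_conv)
  with letters show ?case by (auto intro: block_list.letters)
next
  case (merge xs v u ys)
  have "as @ cs @ bs = xs @ [v @ u] @ ys" using merge by simp
  then show ?case
  proof (cases rule: append3_split_at)
    case (left t)
    then have "xs @ [v, u] @ ys = (xs @ [v, u] @ t) @ cs @ bs" by simp
    then show ?thesis by (rule merge.hyps)
  next
    case (mid s t)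
    then have "xs @ [v, u] @ ys = as @ (s @ [v, u] @ t) @ bs" by simp
    then have "block_list A r (s @ [v, u] @ t)" by (rule merge.hyps)
    then have "block_list A r (s @ [v @ u] @ t)"
      by (rule block_list.merge) (use merge.hyps(3,4) mid in auto)
    then show ?thesis using mid by simp
  next
    case (right s)
    then have "xs @ [v, u] @ ys = as @ cs @ (s @ [v, u] @ ys)" by simp
    then show ?thesis by (rule merge.hyps)
  qed
qed

text \<open>Decides whether a grouping survives the merge of \<open>v\<close> and \<open>u\<close>;
  it does in the case \<open>inside\<close>. Nonemptiness of the groups ensures that in the other
  case the groups of \<open>v\<close> and \<open>u\<close> are adjacent.\<close>

lemma concat_eq_append_pair_cases:
  assumes "concat bss = xs @ [v, u] @ ys" and "[] \<notin> set bss"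
  obtains (inside) p g g' q where "bss = p @ [g @ [v, u] @ g'] @ q"
      "xs = concat p @ g" "ys = g' @ concat q"
    | (boundary) p g g' q where "bss = p @ [g @ [v], u # g'] @ q"
      "xs = concat p @ g" "ys = g' @ concat q"
proof -
  have "concat bss = (xs @ [v]) @ (u # ys)" "bss \<noteq> []" using assms by auto
  then obtain p g g' q where bss: "bss = p @ (g @ g') # q"
    and 1: "xs @ [v] = concat p @ g" and 2: "u # ys = g' @ concat q"
    using concat_eq_appendD by blast
  \<comment> \<open>The cut between \<open>v\<close> and \<open>u\<close> falls in the group
    \<open>g @ g'\<close>. If it is at the left end, \<open>v\<close> closes the preceding group; if
    at the right end, \<open>u\<close> opens the following one.\<close>
  consider "g = []" "g' \<noteq> []" | "g \<noteq> []" "g' = []" | "g \<noteq> []" "g' \<noteq> []"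
    using assms(2) bss by auto
  then show thesis
  proof cases
    case 1
    with \<open>xs @ [v] = concat p @ g\<close> obtain p' h where p: "p = p' @ [h]" by (cases p rule: rev_cases) auto
    with assms(2) bss obtain h' z where "h = h' @ [z]" by (cases h rule: rev_cases) auto
    with 1 2 \<open>xs @ [v] = concat p @ g\<close> p bss that(2)[of p' h' "tl g'" q] show thesis
      by (cases g') auto
  next
    case 2
    with \<open>u # ys = g' @ concat q\<close> obtain h q' where q: "q = h # q'" by (cases q) auto
    with assms(2) bss obtain z h' where "h = z # h'" by (cases h) auto
    with 2 \<open>u # ys = g' @ concat q\<close> \<open>xs @ [v] = concat p @ g\<close> q bss
      that(2)[of p "butlast g" h' q'] show thesis
      by (cases g rule: rev_cases) auto
  next
    case 3
    with \<open>u # ys = g' @ concat q\<close> \<open>xs @ [v] = concat p @ g\<close> bss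
      that(1)[of p "butlast g" "tl g'" q] show thesis
      by (cases g rule: rev_cases; cases g') auto
  qed
qed

section \<open>Order and factorizations in a Nyldon-like set\<close>

locale nyldon_like_set =
  fixes A :: "'a set" and G :: "'a list set" and r :: "'a list rel"
  assumes nyldon_like: "nyldon_like A G r"
begin

lemma Nil_notin_G: "[] \<notin> G"
  using nyldon_like by (auto simp: nyldon_like_def nonempty_words_def)

lemma G_subset_lists: "G \<subseteq> lists A"
  using nyldon_like by (auto simp: nyldon_like_def nonempty_words_def)

lemma letter_in_G: "a \<in> A \<Longrightarrow> [a] \<in> G"
  using nyldon_like by (simp add: nyldon_like_def)

lemma linear_order_G: "linear_order_on G r"
  using nyldon_like by (simp add: nyldon_like_def)

lemma r_refl: "u \<in> G \<Longrightarrow> (u, u) \<in> r"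
  using linear_order_G
  by (auto simp: linear_order_on_def partial_order_on_def preorder_on_def refl_on_def)

lemma r_trans: "(u, v) \<in> r \<Longrightarrow> (v, w) \<in> r \<Longrightarrow> (u, w) \<in> r"
  using linear_order_G
  unfolding linear_order_on_def partial_order_on_def preorder_on_def by (meson transD)

lemma r_antisym: "(u, v) \<in> r \<Longrightarrow> (v, u) \<in> r \<Longrightarrow> u = v"
  using linear_order_G
  unfolding linear_order_on_def partial_order_on_def by (meson antisymD)

lemma not_prec_iff: "u \<in> G \<Longrightarrow> v \<in> G \<Longrightarrow> \<not> prec r v u \<longleftrightarrow> (u, v) \<in> r"
  using linear_order_G r_refl r_antisym unfolding prec_def linear_order_on_def total_on_def by metis

lemma prec_append: "f \<in> G \<Longrightarrow> g \<in> G \<Longrightarrow> f @ g \<in> G \<Longrightarrow> prec r f (f @ g)"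
  using nyldon_like by (simp add: nyldon_like_def)

text \<open>A word of \<open>G\<close> is its own single factor. A word outside \<open>G\<close> is
  not a letter, so the defining equivalence supplies a factorization.\<close>

lemma factorization_exists:
  assumes "w \<in> nonempty_words A"
  shows "\<exists>ws. G_factorization G r w ws"
proof (cases "w \<in> G")
  case True
  then have "G_factorization G r w [w]" by (simp add: G_factorization_def)
  then show ?thesis ..
next
  case False
  have "length w \<ge> 2"
  proof (rule ccontr)
    assume "\<not> length w \<ge> 2"
    with assms obtain a where "w = [a]" "a \<in> A"
      by (cases w; cases "tl w") (auto simp: nonempty_words_def)
    with False letter_in_G show False by simp
  qed
  with assms False nyldon_like show ?thesis by (auto simp: nyldon_like_def)
qed

lemma length_le_length_concat: "set ws \<subseteq> G \<Longrightarrow> length ws \<le> length (concat ws)"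
proof (induction ws)
  case (Cons w ws)
  then have "length w \<ge> 1" using Nil_notin_G by (cases w) auto
  with Cons show ?case by simp
qed simp

text \<open>The defining equivalence speaks only of words of length at least 2, but two nonempty
  factors force that length.\<close>

lemma factorization_of_G_length:
  assumes "w \<in> G" and "G_factorization G r w ws"
  shows "length ws < 2"
proof (rule ccontr)
  assume "\<not> length ws < 2"
  moreover from this have "length w \<ge> 2"
    using assms length_le_length_concat[of ws] by (auto simp: G_factorization_def)
  moreover have "w \<in> nonempty_words A"
    using assms Nil_notin_G G_subset_lists by (auto simp: nonempty_words_def)
  ultimately show False using assms nyldon_like by (auto simp: nyldon_like_def)
qed

section \<open>Minimal blocks\<close>

lemma minimal_block_iff:
  assumes "set bs \<subseteq> G"
  shows "minimal_block r bs u \<longleftrightarrow> u \<in> set bs \<and> (\<forall>c\<in>set bs. (u, c) \<in> r)"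
  using assms not_prec_iff unfolding minimal_block_def by blast

lemma minimal_block_exists:
  assumes "set bs \<subseteq> G" and "bs \<noteq> []"
  shows "\<exists>u. minimal_block r bs u"
  using assms
proof (induction bs rule: induct_list012)
  case (3 b c bs)
  then obtain u where u: "minimal_block r (c # bs) u" by auto
  then have uG: "u \<in> G" using 3 by (auto simp: minimal_block_def)
  have bG: "b \<in> G" using 3 by simp
  show ?case
  proof (cases "(u, b) \<in> r")
    case True
    with u 3 show ?thesis by (auto simp: minimal_block_iff)
  next
    case False
    then have "(b, u) \<in> r" using not_prec_iff uG bG by (auto simp: prec_def)
    then have "minimal_block r (b # c # bs) b"
      using u 3 r_refl[OF bG] by (auto simp: minimal_block_iff intro: r_trans)
    then show ?thesis ..
  qed
next
  case (2 b)
  have "minimal_block r [b] b" by (simp add: minimal_block_def prec_def)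
  then show ?case ..
qed simp

text \<open>Turns the index chosen by the procedure into the decomposition and the comparisons that
  \<open>block_list.merge\<close> asks for.\<close>

lemma leftmost_min_split:
  assumes G: "set bs \<subseteq> G" and ne: "bs \<noteq> []" and hd: "\<not> minimal_block r bs (hd bs)"
  obtains xs v u ys where "bs = xs @ [v, u] @ ys" "leftmost_min r bs = Suc (length xs)"
    "minimal_block r bs u" "\<forall>c\<in>set (xs @ [v]). prec r u c"
proof -
  let ?P = "\<lambda>i. i < length bs \<and> minimal_block r bs (bs ! i)"
  define i where "i = leftmost_min r bs"
  obtain u where "minimal_block r bs u" using minimal_block_exists[OF G ne] ..
  then obtain k where "?P k" by (auto simp: minimal_block_def in_set_conv_nth)
  then have i: "?P i" unfolding i_def leftmost_min_def by (rule LeastI)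
  have less: "\<not> ?P j" if "j < i" for j
    using that not_less_Least unfolding i_def leftmost_min_def by blast
  have "i \<noteq> 0" using i hd ne by (metis hd_conv_nth)
  then obtain j where j: "i = Suc j" by (cases i) auto
  have "bs = take j bs @ [bs ! j, bs ! i] @ drop (Suc i) bs"
    using i j by (metis Cons_nth_drop_Suc Suc_lessD append_Cons append_Nil append_take_drop_id)
  moreover have "i = Suc (length (take j bs))" using i j by simp
  moreover have "prec r (bs ! i) c" if "c \<in> set (take j bs @ [bs ! j])" for c
  proof -
    have "take j bs @ [bs ! j] = take i bs" using i j by (simp add: take_Suc_conv_app_nth)
    with that obtain l where l: "l < i" "c = bs ! l" by (auto simp: in_set_conv_nth)
    then have c: "c \<in> set bs" "\<not> minimal_block r bs c" using less[of l] i by auto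
    \<comment> \<open>A block equal to \<open>bs ! i\<close> further left would itself be minimal,
      against the choice of \<open>i\<close>; this makes the comparison strict.\<close>
    then have "c \<noteq> bs ! i" using i by auto
    with c i G show ?thesis by (auto simp: minimal_block_iff prec_def)
  qed
  ultimately show thesis
    using that[of "take j bs" "bs ! j" "bs ! i" "drop (Suc i) bs"] i unfolding i_def by blast
qed

section \<open>Coherence: blocks in \<open>G\<close>, factorizations as groupings\<close>

definition refined_by :: "'a list list \<Rightarrow> 'a list list \<Rightarrow> bool" where
  "refined_by ws bs \<longleftrightarrow> (\<exists>bss. concat bss = bs \<and> map concat bss = ws)"

text \<open>Both properties are carried through one induction, because the proof that a merged block
  lies in \<open>G\<close> uses the grouping property of the pair being merged.\<close>

definition coherent :: "'a list list \<Rightarrow> bool" where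
  "coherent bs \<longleftrightarrow> set bs \<subseteq> G \<and>
     (\<forall>ws. G_factorization G r (concat bs) ws \<longrightarrow> refined_by ws bs)"

text \<open>Continuing the merging inside a word of \<open>G\<close> ends with that single word as the only block,
  and merging never lowers the minimum.\<close>

lemma concat_in_G_bounds:
  assumes coh: "\<And>ds. block_list A r ds \<Longrightarrow> length (concat ds) \<le> length (concat cs) \<Longrightarrow> coherent ds"
    and "block_list A r cs" and "concat cs \<in> G"
  shows "(\<forall>u. (\<forall>c\<in>set cs. (u, c) \<in> r) \<longrightarrow> (u, concat cs) \<in> r) \<and>
    (minimal_block r cs (hd cs) \<longrightarrow> length cs = 1)"
  using assms
\<comment> \<open>The measure is the number of blocks: a merge lowers it while keeping the word,
  which is why \<open>coh\<close> has a non-strict length bound.\<close>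
proof (induction "length cs" arbitrary: cs rule: less_induct)
  case less
  have cG: "set cs \<subseteq> G" using less.prems by (auto simp: coherent_def)
  have ne: "cs \<noteq> []" using less.prems(3) Nil_notin_G by auto
  \<comment> \<open>If blocks \<open>t\<close> followed a minimal first block \<open>m\<close>, then
    \<open>m\<close> could be put in front of a factorization of \<open>concat t\<close>: the first
    factor is a group of blocks above \<open>m\<close>, hence itself above \<open>m\<close> by
    induction. The word of \<open>G\<close> would then have at least two factors.\<close>
  have hd: "length cs = 1" if min: "minimal_block r cs (hd cs)"
  proof (rule ccontr)
    assume "length cs \<noteq> 1"
    with ne obtain m t where cs: "cs = m # t" "t \<noteq> []" by (cases cs) auto
    have bt: "block_list A r t" using block_list_sublist[of A r "[m]" t "[]"] less.prems(2) cs by simp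
    have tG: "set t \<subseteq> G" and mG: "m \<in> G" using cG cs by auto
    then have "concat t \<noteq> []" using cs(2) Nil_notin_G by (cases t) auto
    then have "concat t \<in> nonempty_words A"
      using block_list_concat_in_lists[OF bt] by (simp add: nonempty_words_def)
    then obtain ts where ts: "G_factorization G r (concat t) ts" using factorization_exists by blast
    have "coherent t" using less.prems(1)[OF bt] cs by simp
    then obtain tss where tss: "concat tss = t" "map concat tss = ts"
      using ts by (auto simp: coherent_def refined_by_def)
    obtain g gs where g: "tss = g # gs" using tss ts by (cases tss) (auto simp: G_factorization_def)
    have bg: "block_list A r g"
      using block_list_sublist[of A r "[]" g "concat gs"] bt tss(1) g by simp
    have gG: "concat g \<in> G" using ts tss g by (auto simp: G_factorization_def)
    have "length (concat g) \<le> length (concat cs)" "length g < length cs" using cs tss(1) g by auto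
    then have "\<forall>u. (\<forall>c\<in>set g. (u, c) \<in> r) \<longrightarrow> (u, concat g) \<in> r"
      using less.hyps[of g] less.prems(1) bg gG by (meson order_trans)
    moreover have "\<forall>c\<in>set g. (m, c) \<in> r"
      using min cs tss(1) g cG by (auto simp: minimal_block_iff)
    ultimately have "(m, concat g) \<in> r" by blast
    then have "G_factorization G r (concat cs) (m # ts)"
      using ts tss g cs mG by (auto simp: G_factorization_def)
    then have "length (m # ts) < 2" using factorization_of_G_length less.prems(3) by blast
    then show False using ts by (auto simp: G_factorization_def)
  qed
  have "(u, concat cs) \<in> r" if u: "\<forall>c\<in>set cs. (u, c) \<in> r" for u
  proof (cases "minimal_block r cs (hd cs)")
    case True
    then have "length cs = 1" by (rule hd)
    then obtain c where "cs = [c]" by (auto simp: length_Suc_conv)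
    with u show ?thesis by simp
  next
    case False
    with cG ne obtain xs v m ys where cs: "cs = xs @ [v, m] @ ys"
      and m: "minimal_block r cs m" "\<forall>c\<in>set (xs @ [v]). prec r m c"
      using leftmost_min_split by metis
    let ?ds = "xs @ [v @ m] @ ys"
    have bd: "block_list A r ?ds"
      using less.prems(2) m cs cG by (intro block_list.merge) (auto simp: minimal_block_iff)
    have eq: "concat ?ds = concat cs" using cs by simp
    have "coherent ?ds" using less.prems(1)[OF bd] unfolding eq by simp
    \<comment> \<open>Coherence puts \<open>v @ m\<close> into \<open>G\<close>, so the third
      Nyldon-like axiom applies: the new block exceeds \<open>v\<close>, and every lower bound of
      the old blocks remains one.\<close>
    then have "prec r v (v @ m)" using cG cs by (intro prec_append) (auto simp: coherent_def)
    then have "(u, v @ m) \<in> r" using u cs r_trans by (auto simp: prec_def)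
    then have "\<forall>c\<in>set ?ds. (u, c) \<in> r" using u cs by auto
    moreover have "\<forall>u. (\<forall>c\<in>set ?ds. (u, c) \<in> r) \<longrightarrow> (u, concat ?ds) \<in> r"
      using less.hyps[of ?ds] less.prems(1,3) bd eq cs by simp
    ultimately show ?thesis using eq by metis
  qed
  with hd show ?case by blast
qed

lemma coherent_merge:
  assumes short: "\<And>ds. block_list A r ds \<Longrightarrow>
      length (concat ds) < length (concat (xs @ [v, u] @ ys)) \<Longrightarrow> coherent ds"
    and b: "block_list A r (xs @ [v, u] @ ys)"
    and coh: "coherent (xs @ [v, u] @ ys)"
    and uv: "\<forall>c\<in>set (xs @ [v]). prec r u c" and uy: "\<forall>c\<in>set ys. (u, c) \<in> r"
  shows "coherent (xs @ [v @ u] @ ys)"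
proof -
  let ?bs = "xs @ [v, u] @ ys"
  have bG: "set ?bs \<subseteq> G" using coh by (simp add: coherent_def)
  have b2: "block_list A r [v, u]" using block_list_sublist[OF b] .
  \<comment> \<open>Either the pair is the whole list, or its word is strictly shorter and
    \<open>short\<close> applies.\<close>
  have c2: "coherent [v, u]"
  proof (cases "xs = [] \<and> ys = []")
    case True
    then show ?thesis using coh by simp
  next
    case False
    moreover have "[] \<notin> set ?bs" using bG Nil_notin_G by blast
    ultimately have "length (concat [v, u]) < length (concat ?bs)"
      by (cases xs; cases ys) auto
    with short b2 show ?thesis by blast
  qed
  \<comment> \<open>The pair has only two groupings. One makes \<open>v @ u\<close> a factor, hence
    a member of \<open>G\<close>; the other would require \<open>v\<close> to precede or equal
    \<open>u\<close>.\<close>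
  have vuG: "v @ u \<in> G"
  proof (rule ccontr)
    assume nG: "v @ u \<notin> G"
    have "v @ u \<in> nonempty_words A"
      using bG Nil_notin_G G_subset_lists by (auto simp: nonempty_words_def)
    then obtain ws where ws: "G_factorization G r (v @ u) ws" using factorization_exists by blast
    then obtain bss where bss: "concat bss = [v, u]" "map concat bss = ws"
      using c2 by (auto simp: coherent_def refined_by_def)
    have ne: "[] \<notin> set bss" using bss ws Nil_notin_G by (force simp: G_factorization_def)
    have "concat bss = [] @ [v, u] @ []" using bss by simp
    then show False using ne
    proof (cases rule: concat_eq_append_pair_cases)
      case (inside p g g' q)
      then have "bss = [[v, u]]" using ne by (cases p; cases q) auto
      then have "ws = [v @ u]" using bss by simp
      then show False using ws nG by (simp add: G_factorization_def)
    next
      case (boundary p g g' q)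
      then have "bss = [[v], [u]]" using ne by (cases p; cases q) auto
      then have "(v, u) \<in> r" using bss ws by (auto simp: G_factorization_def)
      then show False using uv r_antisym by (auto simp: prec_def)
    qed
  qed
  have "refined_by ws (xs @ [v @ u] @ ys)" if ws: "G_factorization G r (concat ?bs) ws" for ws
  proof -
    obtain bss where bss: "concat bss = ?bs" "map concat bss = ws"
      using ws coh by (auto simp: coherent_def refined_by_def)
    have ne: "[] \<notin> set bss" using bss ws Nil_notin_G by (force simp: G_factorization_def)
    from bss(1) ne show ?thesis
    proof (cases rule: concat_eq_append_pair_cases)
      case (inside p g g' q)
      then have "concat (p @ [g @ [v @ u] @ g'] @ q) = xs @ [v @ u] @ ys"
        "map concat (p @ [g @ [v @ u] @ g'] @ q) = ws" using bss by auto
      then show ?thesis unfolding refined_by_def by blast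
    next
      case (boundary p g g' q)
      let ?e = "g @ [v]" and ?f = "u # g'"
      have G: "concat ?e \<in> G" "concat ?f \<in> G" and ef: "(concat ?e, concat ?f) \<in> r"
        using ws bss boundary by (auto simp: G_factorization_def successively_append_iff)
      have be: "block_list A r ?e" and bf: "block_list A r ?f"
        using block_list_sublist[of A r "concat p" ?e "?f @ concat q"]
          block_list_sublist[of A r "concat p @ ?e" ?f "concat q"] b boundary by auto
      \<comment> \<open>Each of the two neighbouring factors is shorter than the whole word, so
        \<open>short\<close> provides the coherence that \<open>concat_in_G_bounds\<close>
        requires.\<close>
      have "concat ?e \<noteq> []" "concat ?f \<noteq> []" using G Nil_notin_G by metis+
      then have lt: "length (concat ?e) < length (concat ?bs)" "length (concat ?f) < length (concat ?bs)"
        using boundary by auto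
      have "minimal_block r ?f (hd ?f)"
        using bG uy boundary r_refl[of u] by (subst minimal_block_iff) auto
      then have "length ?f = 1"
        using concat_in_G_bounds[OF _ bf G(2)] short lt(2) by (meson order_le_less_trans)
      then have f: "concat ?f = u" by simp
      have eG: "set ?e \<subseteq> G" using bG boundary by auto
      \<comment> \<open>The minimum \<open>m\<close> of \<open>?e\<close> is at most
        \<open>concat ?e\<close>, hence at most \<open>u\<close>; yet \<open>u\<close> is strictly
        below every block of \<open>?e\<close>.\<close>
      then obtain m where m: "minimal_block r ?e m" using minimal_block_exists by blast
      then have "(m, concat ?e) \<in> r"
        using concat_in_G_bounds[OF _ be G(1)] short lt(1) eG minimal_block_iff
        by (meson order_le_less_trans)
      then have "(m, u) \<in> r" using ef f r_trans by metis
      moreover have "prec r u m" using m uv boundary by (auto simp: minimal_block_def)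
      ultimately show ?thesis using r_antisym by (auto simp: prec_def)
    qed
  qed
  then show ?thesis using bG vuG by (auto simp: coherent_def)
qed

text \<open>Cutting each factor into its letters yields the required grouping.\<close>

lemma coherent_letters:
  assumes "w \<in> lists A"
  shows "coherent (map (\<lambda>a. [a]) w)"
proof -
  have c: "concat (map (\<lambda>a. [a]) w) = w" for w :: "'a list" by (induction w) auto
  have "refined_by ws (map (\<lambda>a. [a]) w)" if "w = concat ws" for ws
    unfolding refined_by_def
    by (rule exI[of _ "map (map (\<lambda>a. [a])) ws"]) (simp add: that map_concat c comp_def)
  then show ?thesis using assms letter_in_G by (auto simp: coherent_def G_factorization_def c)
qed

text \<open>The outer induction on the length of the word supplies \<open>short\<close> for
  \<open>coherent_merge\<close>; the inner rule induction runs through the merges, which leave the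
  word unchanged.\<close>

lemma block_list_coherent: "block_list A r bs \<Longrightarrow> coherent bs"
proof (induction "length (concat bs)" arbitrary: bs rule: less_induct)
  case less
  from less.prems less.hyps show ?case
  proof (induction rule: block_list.induct)
    case (letters w)
    then show ?case by (simp add: coherent_letters)
  next
    case (merge xs v u ys)
    then show ?case by (intro coherent_merge) auto
  qed
qed

lemma block_list_subset_G: "block_list A r bs \<Longrightarrow> set bs \<subseteq> G"
  using block_list_coherent by (simp add: coherent_def)

section \<open>The run of the procedure\<close>

lemma step_cases:
  assumes "block_list A r bs" and "bs \<noteq> []"
  obtains (emit) b t where "bs = b # t" "minimal_block r bs b" "block_list A r t"
      "step r (bs, out) = (t, out @ [b])"
    | (merge) xs v u ys where "bs = xs @ [v, u] @ ys" "block_list A r (xs @ [v @ u] @ ys)"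
      "step r (bs, out) = (xs @ [v @ u] @ ys, out)"
proof (cases "minimal_block r bs (hd bs)")
  case True
  with assms(2) obtain b t where "bs = b # t" by (cases bs) auto
  with True assms(1) show thesis
    using emit[of b t] block_list_sublist[of A r "[b]" t "[]"] by (simp add: step_def)
next
  case False
  have bG: "set bs \<subseteq> G" using assms(1) by (rule block_list_subset_G)
  with assms(2) False obtain xs v u ys where bs: "bs = xs @ [v, u] @ ys"
    and i: "leftmost_min r bs = Suc (length xs)"
    and u: "minimal_block r bs u" "\<forall>c\<in>set (xs @ [v]). prec r u c"
    using leftmost_min_split by metis
  have "block_list A r (xs @ [v @ u] @ ys)"
    using assms(1) u bs bG by (intro block_list.merge) (auto simp: minimal_block_iff)
  moreover have "step r (bs, out) = (xs @ [v @ u] @ ys, out)"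
    using False i by (simp add: step_def Let_def) (simp add: bs nth_append)
  ultimately show thesis using merge bs by blast
qed

text \<open>Justifies emitting \<open>b\<close>. The first factor is a group that starts with
  \<open>b\<close>, and \<open>b\<close> is minimal in it as well, so
  \<open>concat_in_G_bounds\<close> shrinks this group to \<open>[b]\<close>.\<close>

lemma factorization_Cons_minimal:
  assumes b: "block_list A r (b # t)" and min: "minimal_block r (b # t) b"
    and ws: "G_factorization G r (concat (b # t)) ws"
  obtains ws' where "ws = b # ws'" "concat ws' = concat t"
proof -
  obtain bss where bss: "concat bss = b # t" "map concat bss = ws"
    using ws block_list_coherent[OF b] by (auto simp: coherent_def refined_by_def)
  obtain g gs where g: "bss = g # gs" using bss by (cases bss) auto
  have gG: "concat g \<in> G" using ws bss g by (auto simp: G_factorization_def)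
  then have "g \<noteq> []" using Nil_notin_G by auto
  then obtain g' where g': "g = b # g'" using bss g by (cases g) auto
  have bg: "block_list A r g"
    using block_list_sublist[of A r "[]" g "concat gs"] b bss(1) g by simp
  have "minimal_block r g (hd g)" using min bss g g' by (auto simp: minimal_block_def)
  then have "length g = 1" using concat_in_G_bounds[OF _ bg gG] block_list_coherent by blast
  then have "g = [b]" using g' by simp
  then show thesis using that[of "map concat gs"] bss g concat_map_concat[of gs] by auto
qed

text \<open>Every step lowers the number of blocks by one, which also yields termination. The
  conditions on \<open>ws\<close> are spelled out because \<open>G_factorization\<close> excludes
  the empty list, which is what remains at the end of the run.\<close>

lemma while_option_step_eq_factorization:
  assumes "block_list A r bs" and "set ws \<subseteq> G" and "successively (\<lambda>u v. (u, v) \<in> r) ws"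
    and "concat ws = concat bs"
  shows "while_option (\<lambda>(bs, out). bs \<noteq> []) (step r) (bs, out) = Some ([], out @ ws)"
  using assms
proof (induction "length bs" arbitrary: bs ws out rule: less_induct)
  case less
  show ?case
  proof (cases "bs = []")
    case True
    with less.prems have "ws = []" using Nil_notin_G by (cases ws) auto
    with True show ?thesis by (simp add: while_option_unfold)
  next
    case False
    have unfold: "while_option (\<lambda>(bs, out). bs \<noteq> []) (step r) (bs, out) =
        while_option (\<lambda>(bs, out). bs \<noteq> []) (step r) (step r (bs, out))"
      using False by (subst while_option_unfold) simp
    from less.prems(1) False show ?thesis
    proof (cases rule: step_cases[where out = out])
      case (emit b t)
      have "b \<noteq> []" using block_list_subset_G[OF less.prems(1)] emit Nil_notin_G by auto
      then have "ws \<noteq> []" using less.prems emit by auto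
      then have "G_factorization G r (concat (b # t)) ws"
        using less.prems emit by (cases ws) (auto simp: G_factorization_def)
      then obtain ws' where ws': "ws = b # ws'" "concat ws' = concat t"
        using factorization_Cons_minimal emit less.prems(1) by metis
      have "while_option (\<lambda>(bs, out). bs \<noteq> []) (step r) (t, out @ [b]) =
          Some ([], (out @ [b]) @ ws')"
        using less.hyps[of t ws' "out @ [b]"] emit less.prems ws'
        by (cases ws') auto
      then show ?thesis using unfold emit ws' by simp
    next
      case (merge xs v u ys)
      then have "while_option (\<lambda>(bs, out). bs \<noteq> []) (step r) (xs @ [v @ u] @ ys, out) =
          Some ([], out @ ws)"
        using less.hyps[of "xs @ [v @ u] @ ys" ws out] less.prems by simp
      then show ?thesis using unfold merge by simp
    qed
  qed
qed

lemma reached_block_list: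
  assumes "reached r w s" and "w \<in> lists A"
  shows "block_list A r (fst s)"
  using assms
proof (induction rule: reached.induct)
  case init
  then show ?case by (simp add: initial_state_def block_list.letters)
next
  case (step bs out)
  then have "block_list A r bs" by simp
  then show ?case using step(2) by (cases rule: step_cases[where out = out]) auto
qed

end

theorem theorem3p8:
  fixes A :: "'a set" and G :: "'a list set" and r :: "'a list rel" and w :: "'a list"
  assumes "finite A" and "card A \<ge> 2"
    and "nyldon_like A G r"
    and "w \<in> nonempty_words A"
  shows "(\<exists>!ws. G_factorization G r w ws) \<and>
    (\<exists>ws. procedure_output r w = Some ws \<and> G_factorization G r w ws) \<and>
    (\<forall>bs out. reached r w (bs, out) \<longrightarrow>
       set bs \<subseteq> G \<and>
       (bs \<noteq> [] \<and> \<not> minimal_block r bs (hd bs) \<longrightarrow>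
          (let i = leftmost_min r bs
           in 0 < i \<and> i < length bs \<and> minimal_block r bs (bs ! i) \<and>
              prec r (bs ! i) (bs ! (i - 1)))))"
proof -
  interpret nyldon_like_set A G r using assms(3) by unfold_locales
  have w: "w \<in> lists A" using assms(4) by (simp add: nonempty_words_def)
  have eq: "procedure_output r w = Some ws" if "G_factorization G r w ws" for ws
  proof -
    have "concat (map (\<lambda>a. [a]) w) = w" by (induction w) auto
    then show ?thesis
      using that while_option_step_eq_factorization[OF block_list.letters[OF w], of ws "[]"]
      by (simp add: G_factorization_def procedure_output_def initial_state_def)
  qed
  obtain ws where ws: "G_factorization G r w ws" using factorization_exists[OF assms(4)] ..
  \<comment> \<open>Uniqueness: any two factorizations are the output of the same deterministic
    run.\<close>
  have "\<exists>!ws. G_factorization G r w ws" using ws eq by (metis option.inject)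
  moreover have "\<exists>ws. procedure_output r w = Some ws \<and> G_factorization G r w ws"
    using ws eq by blast
  moreover have "set bs \<subseteq> G \<and>
       (bs \<noteq> [] \<and> \<not> minimal_block r bs (hd bs) \<longrightarrow>
          (let i = leftmost_min r bs
           in 0 < i \<and> i < length bs \<and> minimal_block r bs (bs ! i) \<and>
              prec r (bs ! i) (bs ! (i - 1))))" if "reached r w (bs, out)" for bs out
  proof (intro conjI impI; (elim conjE)?)
    show bG: "set bs \<subseteq> G" using reached_block_list[OF that w] block_list_subset_G by simp
    assume "bs \<noteq> []" "\<not> minimal_block r bs (hd bs)"
    with bG obtain xs v u ys where bs: "bs = xs @ [v, u] @ ys"
      and i: "leftmost_min r bs = Suc (length xs)"
      and u: "minimal_block r bs u" "\<forall>c\<in>set (xs @ [v]). prec r u c"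
      using leftmost_min_split by metis
    have "bs ! Suc (length xs) = u" "bs ! length xs = v" "Suc (length xs) < length bs"
      using bs by (auto simp: nth_append)
    with i u show "let i = leftmost_min r bs
           in 0 < i \<and> i < length bs \<and> minimal_block r bs (bs ! i) \<and>
              prec r (bs ! i) (bs ! (i - 1))"
      by (simp add: Let_def)
  qed
  ultimately show ?thesis by blast
qed

end
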